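(* Let $0<\epsilon<2$ be a constant. For any $k$ permutations $\sigma_1,\dots,\sigma_k:[n]\to[n]$ with $k\le\log\log n-\log\log\frac{2}{\epsilon}-2$ and any arrival order $\pi:[n]\to[n]$, there is a bipartite graph $G=(A,B,E)$ with $A=B=[n]$ that contains a perfect matching and such that for every $i\in\{1,\dots,k\}$, $$|\textsc{Ranking}(G,\pi,\sigma_i)|\le\left(\tfrac12+\epsilon\right)n+o(n).$$
   Context: For a bipartite graph $G=(A,B,E)$, an arrival order $\pi$ of the $A$-vertices and a ranking (permutation) $\sigma$ of the $B$-vertices, $\textsc{Ranking}(G,\pi,\sigma)$ is the matching produced as follows: the $A$-vertices arrive one by one in the order $\pi$, and each arriving vertex $a$ is matched to its unmatched neighbour $b$ of minimum rank $\sigma(b)$; if $a$ has no unmatched neighbour it stays unmatched. $\log$ denotes the binary logarithm. *)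

theory Defs
  imports Complex_Main "HOL-Library.Landau_Symbols" "HOL-Combinatorics.Permutations"
begin

text \<open>
  An edge of a bipartite graph is an ordered pair of its \<open>A\<close>-endpoint and its \<open>B\<close>-endpoint. The two
  sides are thereby disjoint copies even if \<open>A\<close> and \<open>B\<close> are the same set of labels.
\<close>

definition bipartite_graph :: "'a set \<Rightarrow> 'b set \<Rightarrow> ('a \<times> 'b) set \<Rightarrow> bool" where
  "bipartite_graph A B E \<longleftrightarrow> finite A \<and> finite B \<and> E \<subseteq> A \<times> B"

definition matching :: "('a \<times> 'b) set \<Rightarrow> ('a \<times> 'b) set \<Rightarrow> bool" where
  "matching E M \<longleftrightarrow> M \<subseteq> E \<and> inj_on fst M \<and> inj_on snd M"

definition perfect_matching :: "'a set \<Rightarrow> 'b set \<Rightarrow> ('a \<times> 'b) set \<Rightarrow> ('a \<times> 'b) set \<Rightarrow> bool" where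
  "perfect_matching A B E M \<longleftrightarrow> matching E M \<and> fst ` M = A \<and> snd ` M = B"

definition free_neighbours :: "('a \<times> 'b) set \<Rightarrow> ('a \<times> 'b) set \<Rightarrow> 'a \<Rightarrow> 'b set" where
  "free_neighbours E M a = {b. (a, b) \<in> E \<and> b \<notin> snd ` M}"

definition ranking_step ::
    "('a \<times> 'b) set \<Rightarrow> ('b \<Rightarrow> nat) \<Rightarrow> 'a \<Rightarrow> ('a \<times> 'b) set \<Rightarrow> ('a \<times> 'b) set" where
  "ranking_step E \<sigma> a M =
     (if free_neighbours E M a = {} then M
      else insert (a, arg_min_on \<sigma> (free_neighbours E M a)) M)"

text \<open>
  The vertex \<open>\<pi> t\<close> is the one arriving at time \<open>t \<in> {1..n}\<close>, whereas \<open>\<sigma> b\<close> is the rank of the vertex \<open>b\<close>.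
\<close>

definition ranking ::
    "nat \<Rightarrow> ('a \<times> 'b) set \<Rightarrow> (nat \<Rightarrow> 'a) \<Rightarrow> ('b \<Rightarrow> nat) \<Rightarrow> ('a \<times> 'b) set" where
  "ranking n E \<pi> \<sigma> = fold (ranking_step E \<sigma>) (map \<pi> [1..<Suc n]) {}"

end

theory Submission
  imports Defs "HOL-Real_Asymp.Real_Asymp"
begin

text \<open>
  By the Erdos-Szekeres theorem, any \<open>s ^ 2 ^ k\<close> vertices of \<open>B\<close> contain \<open>s\<close> vertices on which every
  \<open>\<sigma>\<^sub>i\<close> is increasing or decreasing. Splitting off such blocks greedily covers all but at most
  \<open>s ^ 2 ^ k \<le> sqrt n\<close> vertices (assuming \<open>\<epsilon> < 1 / 2\<close>; otherwise the bound is trivial). On a block of \<open>s = 2 * m + 1\<close> vertices there is one graph with a perfect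
  matching on which both the increasing and the decreasing ranking match only \<open>m + 1\<close> vertices; the
  disjoint union of these graphs, taken in order of arrival, is the required \<open>G\<close>.
\<close>

section \<open>Monotone subsets for several rankings at once (Erdos-Szekeres)\<close>

definition monotone_either_on :: "'a::linorder set \<Rightarrow> ('a \<Rightarrow> 'b::linorder) \<Rightarrow> bool" where
  "monotone_either_on Y f \<longleftrightarrow> monotone_on Y (<) (<) f \<or> monotone_on Y (<) (>) f"

lemma monotone_either_on_subset:
  "monotone_either_on Y f \<Longrightarrow> Z \<subseteq> Y \<Longrightarrow> monotone_either_on Z f"
  unfolding monotone_either_on_def by (meson monotone_on_subset)

text \<open>Label each element with the size of a largest increasing subset that ends in it. If no
  increasing subset has \<open>r\<close> elements, at most \<open>r\<close> labels occur, so some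
  label is shared by \<open>r\<close> elements, and elements with the same label must be
  decreasing.\<close>

lemma erdos_szekeres:
  fixes f :: "'a::linorder \<Rightarrow> 'b::linorder"
  assumes "finite X" and inj: "inj_on f X" and card: "r * r \<le> card X"
  shows "\<exists>Y\<subseteq>X. card Y = r \<and> monotone_either_on Y f"
proof (cases "\<exists>Y\<subseteq>X. card Y = r \<and> monotone_on Y (<) (<) f")
  case True
  then show ?thesis by (auto simp: monotone_either_on_def)
next
  case False
  have "r > 0"
  proof (rule gr0I)
    assume "r = 0"
    then show False using False by (auto simp: monotone_on_def dest!: spec[of _ "{}"])
  qed
  \<comment> \<open>\<open>S x\<close> collects the increasing subsets with largest element
    \<open>x\<close>; \<open>L x\<close> is the label.\<close>
  define S where "S x = {Y. Y \<subseteq> X \<and> x \<in> Y \<and> (\<forall>y\<in>Y. y \<le> x) \<and> monotone_on Y (<) (<) f}" for x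
  define L where "L x = Max (card ` S x)" for x
  have fin: "finite (S x)" for x
    by (rule finite_subset[of _ "Pow X"]) (use \<open>finite X\<close> in \<open>auto simp: S_def\<close>)
  have ne: "S x \<noteq> {}" if "x \<in> X" for x
  proof -
    have "{x} \<in> S x" using that by (auto simp: S_def monotone_on_def)
    then show ?thesis by blast
  qed
  have attained: "\<exists>Y\<in>S x. card Y = L x" if "x \<in> X" for x
    using Max_in[of "card ` S x"] fin ne[OF that] unfolding L_def by fastforce
  have L_less: "L x < r" if x: "x \<in> X" for x
  proof (rule ccontr)
    assume "\<not> L x < r"
    then obtain Y where Y: "Y \<in> S x" "r \<le> card Y" using attained[OF x] by force
    then obtain Z where "Z \<subseteq> Y" "card Z = r" by (meson obtain_subset_with_card_n)
    moreover have "Y \<subseteq> X" "monotone_on Y (<) (<) f" using Y by (auto simp: S_def)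
    moreover from this have "monotone_on Z (<) (<) f" using \<open>Z \<subseteq> Y\<close> by (auto simp: monotone_on_def)
    ultimately have "\<exists>Z\<subseteq>X. card Z = r \<and> monotone_on Z (<) (<) f"
      by (intro exI[of _ Z]) auto
    with False show False by contradiction
  qed
  have L_mono: "L x < L y" if xy: "x \<in> X" "y \<in> X" "x < y" "f x < f y" for x y
  proof -
    obtain Y where Y: "Y \<in> S x" "card Y = L x" using attained xy by blast
    \<comment> \<open>Since \<open>x\<close> is the last element of \<open>Y\<close>, its value is
      the largest on \<open>Y\<close>, so \<open>y\<close> can be appended and the label
      grows.\<close>
    have "f z \<le> f x" if "z \<in> Y" for z
      using that Y unfolding S_def monotone_on_def by (auto simp: le_less)
    with Y xy have "insert y Y \<in> S y"
      unfolding S_def monotone_on_def by (auto intro: le_less_trans dest: order.strict_trans1)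
    then have "card (insert y Y) \<le> L y" unfolding L_def using fin by simp
    moreover have "y \<notin> Y" "finite Y"
      using Y xy \<open>finite X\<close> by (auto simp: S_def dest: finite_subset)
    ultimately show ?thesis using Y by simp
  qed
  \<comment> \<open>Pigeonhole: \<open>r\<close> label classes, each with fewer than
    \<open>r\<close> elements, could not cover the \<open>r * r\<close> elements of
    \<open>X\<close>.\<close>
  have "\<exists>l\<in>{..<r}. r \<le> card {x\<in>X. L x = l}"
  proof (rule ccontr)
    assume "\<not> ?thesis"
    then have "card {x\<in>X. L x = l} < r" if "l < r" for l using that by force
    then have "(\<Sum>l<r. card {x\<in>X. L x = l}) < (\<Sum>l<r. r)"
      using \<open>r > 0\<close> by (intro sum_strict_mono) auto
    moreover have "(\<Sum>l<r. card {x\<in>X. L x = l}) = card (\<Union>l<r. {x\<in>X. L x = l})"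
      using \<open>finite X\<close> by (subst card_UN_disjoint) auto
    moreover have "(\<Union>l<r. {x\<in>X. L x = l}) = X" using L_less by auto
    ultimately show False using card by simp
  qed
  then obtain l Z where Z: "Z \<subseteq> {x\<in>X. L x = l}" "card Z = r"
    by (meson obtain_subset_with_card_n)
  have "f y < f x" if xy: "x \<in> Z" "y \<in> Z" "x < y" for x y
  proof -
    have "x \<in> X" "y \<in> X" "L x = L y" using Z xy by auto
    then show ?thesis using L_mono[of x y] inj \<open>x < y\<close>
      by (metis inj_onD less_irrefl linorder_neqE)
  qed
  then have "monotone_on Z (<) (>) f" by (simp add: monotone_on_def)
  with Z show ?thesis by (auto simp: monotone_either_on_def)
qed

text \<open>Apply the single-function version once per member of \<open>I\<close>. Each application
  takes the square root of the size, which explains the exponent \<open>2 ^ card I\<close>;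
  monotonicity already gained survives passing to subsets.\<close>

lemma erdos_szekeres_family:
  fixes f :: "'i \<Rightarrow> 'a::linorder \<Rightarrow> 'b::linorder"
  assumes "finite I" "finite X" "\<And>i. i \<in> I \<Longrightarrow> inj_on (f i) X" "r ^ (2 ^ card I) \<le> card X"
  shows "\<exists>Y\<subseteq>X. card Y = r \<and> (\<forall>i\<in>I. monotone_either_on Y (f i))"
  using assms
proof (induction I arbitrary: X rule: finite_induct)
  case empty
  then show ?case using obtain_subset_with_card_n[of r X] by auto
next
  case (insert i I)
  have "r ^ (2 ^ card I) * r ^ (2 ^ card I) \<le> card X"
    using insert by (simp add: power_mult power2_eq_square mult.commute[of 2])
  then obtain Z where Z: "Z \<subseteq> X" "card Z = r ^ (2 ^ card I)" "monotone_either_on Z (f i)"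
    using erdos_szekeres[of X "f i" "r ^ (2 ^ card I)"] insert.prems by blast
  then obtain Y where "Y \<subseteq> Z" "card Y = r" "\<forall>i\<in>I. monotone_either_on Y (f i)"
    using insert.IH[of Z] insert.prems by (metis finite_subset inj_on_subset insertCI order_refl)
  moreover from this Z have "monotone_either_on Y (f i)"
    using monotone_either_on_subset[of Z "f i" Y] by simp
  ultimately show ?case using Z by (intro exI[of _ Y]) auto
qed

section \<open>Behaviour of the greedy process on a list of arrivals\<close>

text \<open>The process inspects only edges at the arriving vertices. This allows a union of block
  graphs to be replaced by one block while the arrivals of that block are processed.\<close>

lemma fold_ranking_step_cong:
  assumes "\<And>a. a \<in> set as \<Longrightarrow> E `` {a} = E' `` {a}"
  shows "fold (ranking_step E \<sigma>) as M = fold (ranking_step E' \<sigma>) as M"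
proof (rule fold_cong[OF refl refl])
  fix a assume "a \<in> set as"
  then have "free_neighbours E M' a = free_neighbours E' M' a" for M'
    using assms by (fastforce simp: free_neighbours_def)
  then show "ranking_step E \<sigma> a = ranking_step E' \<sigma> a"
    by (intro ext) (simp add: ranking_step_def)
qed

lemma ranking_step_superset: "M \<subseteq> ranking_step E \<sigma> a M"
  by (auto simp: ranking_step_def)

lemma finite_ranking_step: "finite M \<Longrightarrow> finite (ranking_step E \<sigma> a M)"
  by (auto simp: ranking_step_def)

lemma finite_fold_ranking_step: "finite M \<Longrightarrow> finite (fold (ranking_step E \<sigma>) as M)"
  by (induction as arbitrary: M) (auto simp: finite_ranking_step)

lemma snd_ranking_step:
  assumes "finite E"
  shows "snd ` ranking_step E \<sigma> a M \<subseteq> snd ` M \<union> E `` {a}"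
proof (cases "free_neighbours E M a = {}")
  case False
  \<comment> \<open>Finiteness ensures that \<open>arg_min_on\<close> really picks a free neighbour
    rather than an arbitrary value.\<close>
  have "free_neighbours E M a \<subseteq> snd ` E" by (force simp: free_neighbours_def)
  then have "finite (free_neighbours E M a)" using assms finite_subset by blast
  from arg_min_if_finite(1)[OF this False, of \<sigma>] show ?thesis
    using False by (auto simp: ranking_step_def free_neighbours_def)
qed (auto simp: ranking_step_def)

lemma snd_fold_ranking_step:
  assumes "finite E"
  shows "snd ` fold (ranking_step E \<sigma>) as M \<subseteq> snd ` M \<union> E `` set as"
proof (induction as arbitrary: M)
  case (Cons a as)
  have "snd ` fold (ranking_step E \<sigma>) (a # as) M \<subseteq> snd ` ranking_step E \<sigma> a M \<union> E `` set as"
    using Cons.IH by simp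
  also have "\<dots> \<subseteq> snd ` M \<union> E `` {a} \<union> E `` set as"
    using snd_ranking_step[OF assms] by (rule Un_mono) simp
  also have "\<dots> = snd ` M \<union> E `` set (a # as)" by auto
  finally show ?case .
qed simp

text \<open>An arrival whose neighbours are all occupied in \<open>M\<close> adds nothing, because
  occupied vertices stay occupied; every other arrival adds at most one edge.\<close>

lemma card_fold_ranking_step_le:
  assumes "finite M"
  shows "card (fold (ranking_step E \<sigma>) as M)
    \<le> card M + length (filter (\<lambda>a. \<not> E `` {a} \<subseteq> snd ` M) as)"
  using assms
proof (induction as arbitrary: M)
  case (Cons a as)
  define M' where "M' = ranking_step E \<sigma> a M"
  have "M \<subseteq> M'" by (simp add: M'_def ranking_step_superset)
  \<comment> \<open>The arrivals not blocked by \<open>M'\<close> are among those not blocked by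
    \<open>M\<close>, so filtering twice changes nothing and the lengths can be compared.\<close>
  have "filter (\<lambda>a. \<not> E `` {a} \<subseteq> snd ` M') as
      = filter (\<lambda>a. \<not> E `` {a} \<subseteq> snd ` M') (filter (\<lambda>a. \<not> E `` {a} \<subseteq> snd ` M) as)"
    using image_mono[OF \<open>M \<subseteq> M'\<close>, of snd]
    by (subst filter_filter) (intro filter_cong refl; blast)
  then have "length (filter (\<lambda>a. \<not> E `` {a} \<subseteq> snd ` M') as)
      \<le> length (filter (\<lambda>a. \<not> E `` {a} \<subseteq> snd ` M) as)"
    by (metis length_filter_le)
  moreover have "card M' \<le> card M + (if E `` {a} \<subseteq> snd ` M then 0 else 1)"
    using Cons.prems
    by (auto simp: M'_def ranking_step_def free_neighbours_def card_insert_if)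
  moreover have "card (fold (ranking_step E \<sigma>) as M')
      \<le> card M' + length (filter (\<lambda>a. \<not> E `` {a} \<subseteq> snd ` M') as)"
    using Cons by (simp add: M'_def finite_ranking_step)
  ultimately show ?case
    by (auto simp: M'_def split: if_splits)
qed simp

text \<open>When \<open>x i\<close> arrives, its strictly best neighbour \<open>g i\<close> is still
  free: \<open>M\<close> does not cover it and, by injectivity of \<open>g\<close>, the earlier
  arrivals took other vertices.\<close>

lemma fold_ranking_step_forced:
  fixes \<sigma> :: "'b \<Rightarrow> nat"
  assumes "\<And>i. i < m \<Longrightarrow> (x i, g i) \<in> E"
    and "\<And>i b. i < m \<Longrightarrow> (x i, b) \<in> E \<Longrightarrow> b \<noteq> g i \<Longrightarrow> \<sigma> (g i) < \<sigma> b"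
    and "\<And>i. i < m \<Longrightarrow> g i \<notin> snd ` M"
    and "inj_on g {..<m}"
  shows "fold (ranking_step E \<sigma>) (map x [0..<m]) M = M \<union> (\<lambda>i. (x i, g i)) ` {..<m}"
  using assms
proof (induction m)
  case (Suc m)
  define M' where "M' = M \<union> (\<lambda>i. (x i, g i)) ` {..<m}"
  have "inj_on g {..<m}" using Suc.prems(4) by (rule inj_on_subset) auto
  then have fold: "fold (ranking_step E \<sigma>) (map x [0..<m]) M = M'"
    unfolding M'_def by (intro Suc.IH) (use Suc.prems in auto)
  have "g m \<notin> g ` {..<m}" using Suc.prems(4) by (fastforce simp: inj_on_def)
  then have free: "g m \<in> free_neighbours E M' (x m)"
    using Suc.prems(1,3)[of m] by (auto simp: free_neighbours_def M'_def image_Un image_image)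
  have least: "\<sigma> (g m) < \<sigma> b" if "b \<in> free_neighbours E M' (x m)" "b \<noteq> g m" for b
    using that Suc.prems(2)[of m b] by (auto simp: free_neighbours_def)
  \<comment> \<open>\<open>arg_min_on\<close> is defined by choice; strict minimality makes the
    minimiser unique and so determines the value.\<close>
  have "arg_min_on \<sigma> (free_neighbours E M' (x m)) = g m"
    unfolding arg_min_on_def arg_min_def is_arg_min_def
    using free least by (intro some_equality) force+
  then have "ranking_step E \<sigma> (x m) M' = insert (x m, g m) M'"
    using free by (auto simp: ranking_step_def)
  then show ?case by (simp add: fold) (auto simp: M'_def lessThan_Suc)
qed simp

section \<open>The hard graph on a single block\<close>

text \<open>
  With \<open>b\<^sub>0 < \<dots> < b\<^sub>2\<^sub>m\<close> the vertices of \<open>Y\<close>, the first \<open>m\<close> arrivals see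
  \<open>b\<^sub>2\<^sub>i, b\<^sub>2\<^sub>i\<^sub>+\<^sub>1, b\<^sub>2\<^sub>i\<^sub>+\<^sub>2\<close> and the last \<open>m + 1\<close> arrivals see a single even vertex each.
  An increasing ranking gives \<open>b\<^sub>2\<^sub>i\<close> and a decreasing one \<open>b\<^sub>2\<^sub>i\<^sub>+\<^sub>2\<close> to the \<open>i\<close>-th arrival, so either
  one leaves just one even vertex for the second phase.
\<close>

lemma hard_block:
  fixes Y :: "'b::linorder set" and as :: "'a list" and \<sigma> :: "'i \<Rightarrow> 'b \<Rightarrow> nat"
  assumes "finite Y" and cardY: "card Y = 2 * m + 1"
    and "distinct as" and len: "length as = 2 * m + 1"
    and mono: "\<And>i. i \<in> I \<Longrightarrow> monotone_either_on Y (\<sigma> i)"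
  shows "\<exists>E\<subseteq>set as \<times> Y. (\<exists>P. perfect_matching (set as) Y E P) \<and>
    (\<forall>i\<in>I. \<forall>M. finite M \<longrightarrow> snd ` M \<inter> Y = {} \<longrightarrow>
      card (fold (ranking_step E (\<sigma> i)) as M) \<le> card M + (m + 1))"
proof -
  define b where "b j = sorted_list_of_set Y ! j" for j
  define x where "x j = as ! j" for j
  have b_less: "b i < b j" if "i < j" "j < 2 * m + 1" for i j
    using that cardY strict_sorted_list_of_set[of Y]
    by (simp add: b_def sorted_wrt_nth_less)
  have b_in: "b j \<in> Y" if "j < 2 * m + 1" for j
    using that cardY \<open>finite Y\<close> unfolding b_def
    by (metis length_sorted_list_of_set nth_mem set_sorted_list_of_set)
  have b_eq: "b i = b j \<longleftrightarrow> i = j" if "i < 2 * m + 1" "j < 2 * m + 1" for i j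
    using that b_less[of i j] b_less[of j i] by (cases i j rule: linorder_cases) auto
  have x_in: "x j \<in> set as" if "j < 2 * m + 1" for j
    using that len by (simp add: x_def)
  have x_eq: "x i = x j \<longleftrightarrow> i = j" if "i < 2 * m + 1" "j < 2 * m + 1" for i j
    using that len \<open>distinct as\<close> by (simp add: x_def nth_eq_iff_index_eq)
  have as_eq: "as = map x [0..<m] @ map (\<lambda>j. x (m + j)) [0..<m + 1]"
    by (rule nth_equalityI)
       (auto simp: len x_def nth_append simp del: upt_Suc)
  define E where "E = (\<Union>i<m. {x i} \<times> {b (2*i), b (2*i+1), b (2*i+2)})
    \<union> (\<lambda>j. (x (m + j), b (2*j))) ` {..m}"
  have E1: "(x i, v) \<in> E \<longleftrightarrow> v \<in> {b (2*i), b (2*i+1), b (2*i+2)}" if "i < m" for i v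
    using that x_eq by (fastforce simp: E_def)
  have E2: "E `` {x (m + j)} = {b (2*j)}" if "j \<le> m" for j
    using that x_eq by (fastforce simp: E_def)
  have sub: "E \<subseteq> set as \<times> Y"
    unfolding E_def using x_in b_in by auto
  \<comment> \<open>The perfect matching sends the first \<open>m\<close> arrivals to the
    odd-indexed vertices and leaves every even-indexed vertex to its second-phase arrival.\<close>
  define p where "p t = (if t < m then 2 * t + 1 else 2 * (t - m))" for t
  define P where "P = (\<lambda>t. (x t, b (p t))) ` {..<2 * m + 1}"
  have p_less: "p t < 2 * m + 1" if "t < 2 * m + 1" for t
    using that by (auto simp: p_def)
  have p_eq: "p t = p t' \<longleftrightarrow> t = t'" for t t'
    unfolding p_def by (auto; presburger)
  have "(x t, b (p t)) \<in> E" if "t < 2 * m + 1" for t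
  proof (cases "t < m")
    case True
    then show ?thesis by (simp add: E1 p_def)
  next
    case False
    then have "b (p t) \<in> E `` {x (m + (t - m))}" using that by (subst E2) (auto simp: p_def)
    with False show ?thesis by simp
  qed
  then have "P \<subseteq> E" by (auto simp: P_def)
  moreover have "inj_on fst P" "inj_on snd P"
    using x_eq b_eq p_less p_eq by (auto simp: P_def inj_on_def)
  moreover have "fst ` P = set as"
    using len by (auto simp: P_def x_def image_image set_conv_nth)
  moreover have "snd ` P = Y"
  proof (rule card_subset_eq[OF \<open>finite Y\<close>])
    show "snd ` P \<subseteq> Y" using \<open>P \<subseteq> E\<close> sub by auto
    have "snd ` P = (\<lambda>t. b (p t)) ` {..<2 * m + 1}" by (simp add: P_def image_image)
    moreover have "inj_on (\<lambda>t. b (p t)) {..<2 * m + 1}"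
      using b_eq p_less p_eq by (auto simp: inj_on_def)
    ultimately show "card (snd ` P) = card Y" by (simp add: card_image cardY)
  qed
  ultimately have perfect: "perfect_matching (set as) Y E P"
    by (simp add: perfect_matching_def matching_def)
  \<comment> \<open>One argument for both directions: the \<open>i\<close>-th arrival is forced to
    \<open>b (2 * (i + d))\<close>, with \<open>d = 0\<close> for an increasing and
    \<open>d = 1\<close> for a decreasing ranking.\<close>
  have bound: "card (fold (ranking_step E \<tau>) as M) \<le> card M + (m + 1)"
    if M: "finite M" "snd ` M \<inter> Y = {}"
      and d: "d \<le> 1"
      and min: "\<And>i v. i < m \<Longrightarrow> v \<in> {b (2*i), b (2*i+1), b (2*i+2)} \<Longrightarrow>
            v \<noteq> b (2 * (i + d)) \<Longrightarrow> \<tau> (b (2 * (i + d))) < \<tau> v"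
    for \<tau> :: "'b \<Rightarrow> nat" and M d
  proof -
    define g where "g i = b (2 * (i + d))" for i
    define M' where "M' = M \<union> (\<lambda>i. (x i, g i)) ` {..<m}"
    have fold: "fold (ranking_step E \<tau>) (map x [0..<m]) M = M'"
      unfolding M'_def
    proof (rule fold_ranking_step_forced)
      show "(x i, g i) \<in> E" if "i < m" for i
        using that d by (cases d) (auto simp: E1 g_def)
      show "\<tau> (g i) < \<tau> v" if "i < m" "(x i, v) \<in> E" "v \<noteq> g i" for i v
        using that min by (simp add: E1 g_def)
      show "g i \<notin> snd ` M" if "i < m" for i
        using that d M b_in[of "2 * (i + d)"] by (auto simp: g_def)
      show "inj_on g {..<m}"
        using b_eq d by (auto simp: g_def inj_on_def)
    qed
    have "card M' \<le> card M + m"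
      using card_Un_le[of M] card_image_le[of "{..<m}"] unfolding M'_def
      by (metis (no_types, lifting) add_left_mono card_lessThan finite_lessThan order_trans)
    moreover have "length (filter (\<lambda>a. \<not> E `` {a} \<subseteq> snd ` M') (map (\<lambda>j. x (m + j)) [0..<m + 1])) \<le> 1"
    proof -
      \<comment> \<open>The first phase occupies every even-indexed vertex except the last one
        (\<open>d = 0\<close>) or the first one (\<open>d = 1\<close>); \<open>b (2 * j)\<close>
        goes to arrival \<open>j - d\<close>.\<close>
      have "b (2 * j) \<in> snd ` M'" if "j \<le> m" "j \<noteq> (if d = 0 then m else 0)" for j
      proof -
        have "j - d < m" "(j - d) + d = j" using that d by (auto split: if_splits)
        then have "j - d < m" "b (2 * j) = g (j - d)" by (simp_all only: g_def)
        then show ?thesis by (simp add: M'_def image_Un image_image)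
      qed
      then have "E `` {x (m + j)} \<subseteq> snd ` M'" if "j \<le> m" "j \<noteq> (if d = 0 then m else 0)" for j
        using that by (simp only: E2) blast
      then have "{j. j < m + 1 \<and> \<not> E `` {x (m + j)} \<subseteq> snd ` M'} \<subseteq> {if d = 0 then m else 0}"
        by (intro subsetI) (simp only: mem_Collect_eq singleton_iff less_Suc_eq_le flip: Suc_eq_plus1, blast)
      then have "card {j. j < m + 1 \<and> \<not> E `` {x (m + j)} \<subseteq> snd ` M'} \<le> 1"
        using card_mono[of "{if d = 0 then m else 0}"] by (simp only: finite.intros card.empty
            card_insert_disjoint empty_iff not_False_eq_True One_nat_def)
      then show ?thesis
        by (simp add: filter_map o_def length_filter_conv_card cong: conj_cong del: upt_Suc)
    qed
    moreover have "finite M'" using M by (simp add: M'_def)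
    ultimately show ?thesis
      using card_fold_ranking_step_le[of M' E \<tau> "map (\<lambda>j. x (m + j)) [0..<m + 1]"]
      by (subst as_eq) (simp add: fold del: upt_Suc)
  qed
  have "card (fold (ranking_step E (\<sigma> i)) as M) \<le> card M + (m + 1)"
    if "i \<in> I" "finite M" "snd ` M \<inter> Y = {}" for i M
    using mono[OF \<open>i \<in> I\<close>] unfolding monotone_either_on_def
  proof
    assume "monotone_on Y (<) (<) (\<sigma> i)"
    then have "\<sigma> i (b j) < \<sigma> i (b j')" if "j < j'" "j' < 2 * m + 1" for j j'
      using that b_in[of j] b_in[of j'] b_less[of j j'] by (auto simp: monotone_on_def)
    then show ?thesis by (intro bound[of M 0]) (use that in auto)
  next
    assume "monotone_on Y (<) (>) (\<sigma> i)"
    then have "\<sigma> i (b j') < \<sigma> i (b j)" if "j < j'" "j' < 2 * m + 1" for j j'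
      using that b_in[of j] b_in[of j'] b_less[of j j'] by (auto simp: monotone_on_def)
    then show ?thesis by (intro bound[of M 1]) (use that in auto)
  qed
  then show ?thesis using sub perfect by blast
qed

section \<open>Gluing blocks along the arrival order\<close>

lemma perfect_matching_Un:
  assumes "perfect_matching A B E P" "perfect_matching A' B' E' P'"
    and "A \<inter> A' = {}" "B \<inter> B' = {}"
  shows "perfect_matching (A \<union> A') (B \<union> B') (E \<union> E') (P \<union> P')"
proof -
  have "fst ` (P - P') \<inter> fst ` (P' - P) = {}" "snd ` (P - P') \<inter> snd ` (P' - P) = {}"
    using assms unfolding perfect_matching_def by blast+
  then show ?thesis
    using assms unfolding perfect_matching_def matching_def
    by (auto simp: inj_on_Un image_Un)
qed

text \<open>Induction splitting off one block at a time: each block of \<open>s\<close> vertices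
  contributes at most \<open>m + 1\<close> edges, and the final leftover is paid for once by the
  last summand. The factor \<open>s\<close> avoids division in \<open>nat\<close>. The initial
  matching \<open>M\<close> is arbitrary so that the induction hypothesis applies to the state left
  by the first block.\<close>

lemma hard_graph:
  fixes X :: "'b::linorder set" and as :: "'a list" and \<sigma> :: "'i \<Rightarrow> 'b \<Rightarrow> nat" and m :: nat
  assumes "finite I" "finite X" "distinct as" "length as = card X"
    and "\<And>i. i \<in> I \<Longrightarrow> inj_on (\<sigma> i) X"
  defines "s \<equiv> 2 * m + 1"
  shows "\<exists>E\<subseteq>set as \<times> X. (\<exists>P. perfect_matching (set as) X E P) \<and>
    (\<forall>i\<in>I. \<forall>M. finite M \<longrightarrow> snd ` M \<inter> X = {} \<longrightarrow>
      s * card (fold (ranking_step E (\<sigma> i)) as M)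
        \<le> s * card M + (m + 1) * card X + s * s ^ (2 ^ card I))"
  using assms(2-5)
proof (induction "card X" arbitrary: X as rule: less_induct)
  case less
  show ?case
  proof (cases "s ^ (2 ^ card I) \<le> card X")
    case False
    \<comment> \<open>Too few vertices remain for another block. Any perfect matching serves as the
      graph, since each arrival adds at most one edge.\<close>
    obtain h where h: "bij_betw h (set as) X"
      using less.prems by (metis List.finite_set distinct_card finite_same_card_bij)
    define E where "E = (\<lambda>a. (a, h a)) ` set as"
    have "perfect_matching (set as) X E E"
      using h unfolding perfect_matching_def matching_def E_def bij_betw_def
      by (auto simp: inj_on_def image_image)
    moreover have "E \<subseteq> set as \<times> X" using h by (auto simp: E_def bij_betw_def)
    moreover have "s * card (fold (ranking_step E (\<sigma> i)) as M)
        \<le> s * card M + (m + 1) * card X + s * s ^ (2 ^ card I)" if "finite M" for i M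
    proof -
      have "card (fold (ranking_step E (\<sigma> i)) as M) \<le> card M + length as"
        using card_fold_ranking_step_le[OF that, of E "\<sigma> i" as]
          length_filter_le[of "\<lambda>a. \<not> E `` {a} \<subseteq> snd ` M" as] by linarith
      also have "\<dots> \<le> card M + s ^ (2 ^ card I)" using less.prems False by simp
      finally have "s * card (fold (ranking_step E (\<sigma> i)) as M) \<le> s * (card M + s ^ (2 ^ card I))"
        by (rule mult_left_mono) simp
      then show ?thesis by (simp add: distrib_left)
    qed
    ultimately show ?thesis by blast
  next
    case True
    obtain Y where Y: "Y \<subseteq> X" "card Y = s" "\<forall>i\<in>I. monotone_either_on Y (\<sigma> i)"
      using erdos_szekeres_family[OF \<open>finite I\<close> \<open>finite X\<close> _ True, of \<sigma>] less.prems(4) by blast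
    define as1 as2 where "as1 = take s as" and "as2 = drop s as"
    have as: "as = as1 @ as2" by (simp add: as1_def as2_def)
    have "finite Y" using Y less.prems finite_subset by blast
    have "s \<le> card X" using Y less.prems card_mono by metis
    have cardXY: "card (X - Y) = card X - s"
      using Y \<open>finite Y\<close> by (simp add: card_Diff_subset)
    have "length as1 = s" "distinct as1"
      using \<open>s \<le> card X\<close> less.prems by (simp_all add: as1_def)
    then obtain E1 P1 where E1: "E1 \<subseteq> set as1 \<times> Y" "perfect_matching (set as1) Y E1 P1"
      and b1: "\<And>i M. i \<in> I \<Longrightarrow> finite M \<Longrightarrow> snd ` M \<inter> Y = {} \<Longrightarrow>
        card (fold (ranking_step E1 (\<sigma> i)) as1 M) \<le> card M + (m + 1)"
      using hard_block[of Y m as1 I \<sigma>] Y(2,3) \<open>finite Y\<close> unfolding s_def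
      by (elim meta_impE exE conjE) simp_all
    have "card (X - Y) < card X" using cardXY \<open>s \<le> card X\<close> by (simp add: s_def)
    moreover have "inj_on (\<sigma> i) (X - Y)" if "i \<in> I" for i
      using less.prems(4)[OF that] by (rule inj_on_subset) auto
    ultimately obtain E2 P2 where E2: "E2 \<subseteq> set as2 \<times> (X - Y)"
        "perfect_matching (set as2) (X - Y) E2 P2"
      and b2: "\<And>i M. i \<in> I \<Longrightarrow> finite M \<Longrightarrow> snd ` M \<inter> (X - Y) = {} \<Longrightarrow>
        s * card (fold (ranking_step E2 (\<sigma> i)) as2 M)
          \<le> s * card M + (m + 1) * card (X - Y) + s * s ^ (2 ^ card I)"
      using less.hyps[of "X - Y" as2] less.prems cardXY unfolding as2_def by auto
    have disj: "set as1 \<inter> set as2 = {}" using less.prems as by simp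
    define E where "E = E1 \<union> E2"
    have "perfect_matching (set as) X E (P1 \<union> P2)"
      using perfect_matching_Un[OF E1(2) E2(2) disj] Y as by (simp add: E_def Un_absorb1)
    moreover have "E \<subseteq> set as \<times> X" using E1 E2 Y as by (auto simp: E_def)
    moreover have "s * card (fold (ranking_step E (\<sigma> i)) as M)
        \<le> s * card M + (m + 1) * card X + s * s ^ (2 ^ card I)"
      if "i \<in> I" "finite M" "snd ` M \<inter> X = {}" for i M
    proof -
      define M' where "M' = fold (ranking_step E1 (\<sigma> i)) as1 M"
      have "fold (ranking_step E (\<sigma> i)) as1 M = M'"
        unfolding M'_def by (rule fold_ranking_step_cong) (use disj E2 in \<open>auto simp: E_def\<close>)
      moreover have "fold (ranking_step E (\<sigma> i)) as2 M' = fold (ranking_step E2 (\<sigma> i)) as2 M'"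
        by (rule fold_ranking_step_cong) (use disj E1 in \<open>auto simp: E_def\<close>)
      ultimately have eq: "fold (ranking_step E (\<sigma> i)) as M = fold (ranking_step E2 (\<sigma> i)) as2 M'"
        by (simp add: as)
      have "finite E1" using E1(1) \<open>finite Y\<close> finite_subset by blast
      \<comment> \<open>The first block occupies only vertices of \<open>Y\<close>, so
        \<open>X - Y\<close> is still free when the remaining arrivals start.\<close>
      then have "snd ` M' \<subseteq> snd ` M \<union> Y"
        using snd_fold_ranking_step[of E1 "\<sigma> i" as1 M] E1(1) unfolding M'_def by blast
      then have "s * card (fold (ranking_step E2 (\<sigma> i)) as2 M')
          \<le> s * card M' + (m + 1) * card (X - Y) + s * s ^ (2 ^ card I)"
        using that by (intro b2) (auto simp: M'_def finite_fold_ranking_step)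
      moreover have "card M' \<le> card M + (m + 1)"
        unfolding M'_def using that Y by (intro b1) auto
      then have "s * card M' \<le> s * card M + (m + 1) * s"
        by (metis distrib_left mult.commute mult_le_mono2)
      moreover have "(m + 1) * card X = (m + 1) * s + (m + 1) * card (X - Y)"
        using cardXY \<open>s \<le> card X\<close> by (metis distrib_left le_add_diff_inverse)
      ultimately show ?thesis unfolding eq by linarith
    qed
    ultimately show ?thesis by blast
  qed
qed

section \<open>Choice of parameters and the final estimate\<close>

text \<open>Exponentiate twice to base 2. The subtracted 2 turns into the \<open>+ 2\<close> in the
  exponent of \<open>k\<close>.\<close>

lemma loglog_bound_imp_power_le:
  fixes u :: real
  assumes "1 < u" "2 \<le> n" "real k \<le> log 2 (log 2 (real n)) - log 2 (log 2 u) - 2"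
  shows "u ^ (2 ^ (k + 2)) \<le> real n"
proof -
  have pos: "0 < log 2 u" "0 < log 2 (real n)" using assms by auto
  have "log 2 (2 ^ (k + 2) * log 2 u) = real (k + 2) + log 2 (log 2 u)"
    using pos by (subst log_mult) (auto simp: log_nat_power simp del: power_Suc power_add_numeral2 add_2_eq_Suc')
  also have "\<dots> \<le> log 2 (log 2 (real n))" using assms by simp
  finally have "2 ^ (k + 2) * log 2 u \<le> log 2 (real n)"
    using pos by (subst (asm) log_le_cancel_iff) auto
  then have "log 2 (u ^ (2 ^ (k + 2))) \<le> log 2 (real n)"
    using assms by (subst log_nat_power) auto
  then show ?thesis using assms by (subst (asm) log_le_cancel_iff) auto
qed

theorem theorem13:
  fixes \<epsilon> :: real
  assumes "0 < \<epsilon>" and "\<epsilon> < 2"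
  shows "\<exists>f :: nat \<Rightarrow> real. f \<in> o(\<lambda>n. real n) \<and>
    (\<forall>(n :: nat) (k :: nat) (\<sigma> :: nat \<Rightarrow> nat \<Rightarrow> nat) (\<pi> :: nat \<Rightarrow> nat).
      2 \<le> n \<longrightarrow>
      real k \<le> log 2 (log 2 (real n)) - log 2 (log 2 (2 / \<epsilon>)) - 2 \<longrightarrow>
      (\<forall>i\<in>{1..k}. \<sigma> i permutes {1..n}) \<longrightarrow>
      \<pi> permutes {1..n} \<longrightarrow>
      (\<exists>E :: (nat \<times> nat) set.
        bipartite_graph {1..n} {1..n} E \<and>
        (\<exists>M. perfect_matching {1..n} {1..n} E M) \<and>
        (\<forall>i\<in>{1..k}. real (card (ranking n E \<pi> (\<sigma> i))) \<le> (1 / 2 + \<epsilon>) * real n + f n)))"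
proof (intro exI[of _ "\<lambda>n. sqrt (real n)"] conjI allI impI)
  \<comment> \<open>The error term \<open>sqrt n\<close> accounts for the vertices left over after
    the blocks.\<close>
  show "(\<lambda>n. sqrt (real n)) \<in> o(\<lambda>n. real n)" by real_asymp
next
  fix n k :: nat and \<sigma> :: "nat \<Rightarrow> nat \<Rightarrow> nat" and \<pi> :: "nat \<Rightarrow> nat"
  assume n: "2 \<le> n"
    and k: "real k \<le> log 2 (log 2 (real n)) - log 2 (log 2 (2 / \<epsilon>)) - 2"
    and \<sigma>: "\<forall>i\<in>{1..k}. \<sigma> i permutes {1..n}" and \<pi>: "\<pi> permutes {1..n}"
  \<comment> \<open>The matched fraction of a block is
    \<open>(m + 1) / s = 1/2 + 1 / (2 * s)\<close>, which is below \<open>1/2 + \<epsilon>\<close>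
    once \<open>m\<close> is at least \<open>2 / \<epsilon>\<close>.\<close>
  define u where "u = 2 / \<epsilon>"
  define m where "m = nat \<lceil>u\<rceil>"
  define s where "s = 2 * m + 1"
  define as where "as = map \<pi> [1..<Suc n]"
  have "u > 1" using assms by (simp add: u_def)
  have m: "u \<le> real m" "real m \<le> u + 1" using \<open>u > 1\<close> unfolding m_def by linarith+
  have set_as: "set as = {1..n}"
    using permutes_image[OF \<pi>] by (simp add: as_def atLeastLessThanSuc_atLeastAtMost del: upt_Suc)
  have "distinct as"
    using permutes_inj_on[OF \<pi>] by (simp add: as_def distinct_map del: upt_Suc)
  moreover have "length as = card {1..n}" by (simp add: as_def)
  moreover have "inj_on (\<sigma> i) {1..n}" if "i \<in> {1..k}" for i
    using \<sigma> that permutes_inj_on by blast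
  ultimately obtain E P where E: "E \<subseteq> {1..n} \<times> {1..n}" "perfect_matching {1..n} {1..n} E P"
    and bound: "\<And>i M. i \<in> {1..k} \<Longrightarrow> finite M \<Longrightarrow> snd ` M \<inter> {1..n} = {} \<Longrightarrow>
        s * card (fold (ranking_step E (\<sigma> i)) as M)
          \<le> s * card M + (m + 1) * n + s * s ^ (2 ^ k)"
    using hard_graph[of "{1..k}" "{1..n}" as \<sigma> m] unfolding set_as s_def by auto
  have "real (card (ranking n E \<pi> (\<sigma> i))) \<le> (1 / 2 + \<epsilon>) * real n + sqrt (real n)"
    if i: "i \<in> {1..k}" for i
  \<comment> \<open>For large \<open>\<epsilon>\<close> the trivial bound \<open>n\<close> suffices.
    Small \<open>\<epsilon>\<close> gives \<open>u > 4\<close>, which the estimate of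
    \<open>s\<close> by \<open>u\<^sup>2\<close> uses.\<close>
  proof (cases "\<epsilon> < 1 / 2")
    case False
    have "card (ranking n E \<pi> (\<sigma> i)) \<le> length as"
      using order_trans[OF card_fold_ranking_step_le add_left_mono[OF length_filter_le],
          of "{}" E "\<sigma> i" as]
      by (simp add: ranking_def as_def del: upt_Suc)
    then have "real (card (ranking n E \<pi> (\<sigma> i))) \<le> 1 * real n" by (simp add: as_def del: upt_Suc)
    also have "\<dots> \<le> (1 / 2 + \<epsilon>) * real n" using False by (intro mult_right_mono) auto
    finally show ?thesis by (simp add: add_increasing2)
  next
    case True
    then have "u > 4" using assms by (simp add: u_def field_simps)
    have "real s \<le> 2 * u + 3" using m by (simp add: s_def)
    also have "\<dots> \<le> 4 * u" using \<open>u > 4\<close> by simp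
    also have "\<dots> \<le> u\<^sup>2" using \<open>u > 4\<close> by (simp add: power2_eq_square)
    \<comment> \<open>The two spare units in the exponent \<open>k + 2\<close> are spent here: one
      on replacing \<open>s\<close> by \<open>u\<^sup>2\<close>, the other on bounding the leftover
      by \<open>sqrt n\<close> instead of \<open>n\<close>.\<close>
    finally have "real s ^ (2 ^ (k + 1)) \<le> (u\<^sup>2) ^ (2 ^ (k + 1))" by (intro power_mono) auto
    also have "\<dots> = u ^ (2 ^ (k + 2))" by (simp flip: power_mult)
    also have "\<dots> \<le> real n"
      using loglog_bound_imp_power_le[OF \<open>u > 1\<close> n] k by (simp add: u_def)
    finally have "(real s ^ (2 ^ k))\<^sup>2 \<le> real n" by (simp add: mult.commute flip: power_mult)
    then have R: "real s ^ (2 ^ k) \<le> sqrt (real n)" by (rule real_le_rsqrt)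
    define c where "c = card (ranking n E \<pi> (\<sigma> i))"
    have "s * c \<le> (m + 1) * n + s * s ^ (2 ^ k)"
      using bound[OF i, of "{}"] by (simp add: c_def ranking_def as_def del: upt_Suc)
    then have "real (s * c) \<le> real ((m + 1) * n + s * s ^ (2 ^ k))" by (rule of_nat_mono)
    then have "real s * real c \<le> (real m + 1) * real n + real s * real s ^ (2 ^ k)" by (simp add: algebra_simps)
    also have "\<dots> \<le> (real m + 1) * real n + real s * sqrt (real n)"
      using R by (intro add_left_mono mult_left_mono) auto
    also have "\<dots> \<le> (real s * (1 / 2 + \<epsilon>)) * real n + real s * sqrt (real n)"
    proof (intro add_right_mono mult_right_mono)
      \<comment> \<open>As \<open>s / 2 = m + 1/2\<close>, the claim needs only
        \<open>s * \<epsilon> \<ge> 1/2\<close>; the choice of \<open>u\<close> gives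
        \<open>s * \<epsilon> \<ge> 2\<close>.\<close>
      have "2 = u * \<epsilon>" using assms by (simp add: u_def)
      also have "\<dots> \<le> real s * \<epsilon>" using m assms by (intro mult_right_mono) (auto simp: s_def)
      finally show "real m + 1 \<le> real s * (1 / 2 + \<epsilon>)" by (simp add: s_def algebra_simps)
    qed simp
    also have "\<dots> = real s * ((1 / 2 + \<epsilon>) * real n + sqrt (real n))" by (simp add: algebra_simps)
    finally show ?thesis unfolding c_def by (simp add: s_def)
  qed
  moreover have "bipartite_graph {1..n} {1..n} E" using E by (simp add: bipartite_graph_def)
  ultimately show "\<exists>E. bipartite_graph {1..n} {1..n} E \<and>
      (\<exists>M. perfect_matching {1..n} {1..n} E M) \<and>
      (\<forall>i\<in>{1..k}. real (card (ranking n E \<pi> (\<sigma> i))) \<le> (1 / 2 + \<epsilon>) * real n + sqrt (real n))"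
    using E by blast
qed

end
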